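(* Let $G=(V,E)$ be a finite undirected graph. The algorithm FIND\_MAX-CLIQUE described below, on input $G$, outputs a maximum clique of $G$.
   Context: For $v\in V$, $N_G(v)$ is the neighbor set of $v$, and $v\leftrightarrow_G u$ means $N_G(v)\cup\{v\}=N_G(u)\cup\{u\}$ (an equivalence relation whose classes are called closed neighborhoods). For a partition $\mathcal C'$ of $V$ and $v\in V$, $\mathcal C'[v]$ denotes the unique part of $\mathcal C'$ containing $v$. Algorithm FIND\_MAX-CLIQUE on input $G$: (1) set $U=V$, $\mathcal C'=\emptyset$; (2)–(5) while $U\neq\emptyset$: pick $v\in U$, let $C'=\{u\in U: u\leftrightarrow_G v\}$, add $C'$ to $\mathcal C'$, and set $U=U\setminus C'$; (6) let $G'=(V',E')$ be an induced subgraph of $G$ containing exactly one vertex from each set $C'\in\mathcal C'$; (7) by exhaustive search, find a clique $S$ of $G'$ maximizing $|\bigcup_{v'\in S}\mathcal C'[v']|$; (8) output $Q=\bigcup_{v'\in S}\mathcal C'[v']$. *)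

theory Defs
  imports "HOL-Library.Ramsey"
begin

text \<open>
  A graph is given by its vertex set \<open>V\<close> and its set \<open>E\<close> of two-element edges, in the format
  used by \<^const>\<open>clique\<close>.
\<close>

definition fin_graph :: "'a set \<Rightarrow> 'a set set \<Rightarrow> bool" where
  "fin_graph V E \<longleftrightarrow> finite V \<and> E \<subseteq> {e. e \<subseteq> V \<and> card e = 2}"

definition neighbors :: "'a set set \<Rightarrow> 'a \<Rightarrow> 'a set" where
  "neighbors E v = {u. {v, u} \<in> E}"

definition closed_twins :: "'a set set \<Rightarrow> 'a \<Rightarrow> 'a \<Rightarrow> bool" where
  "closed_twins E v u \<longleftrightarrow> neighbors E v \<union> {v} = neighbors E u \<union> {u}"

definition clique_of :: "'a set \<Rightarrow> 'a set set \<Rightarrow> 'a set \<Rightarrow> bool" where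
  "clique_of V E S \<longleftrightarrow> S \<subseteq> V \<and> clique S E"

definition maximum_clique :: "'a set \<Rightarrow> 'a set set \<Rightarrow> 'a set \<Rightarrow> bool" where
  "maximum_clique V E Q \<longleftrightarrow> is_arg_max card (clique_of V E) Q"

definition induced_edges :: "'a set set \<Rightarrow> 'a set \<Rightarrow> 'a set set" where
  "induced_edges E W = {e \<in> E. e \<subseteq> W}"

definition part_of :: "'a set set \<Rightarrow> 'a \<Rightarrow> 'a set" where
  "part_of P v = (THE C. C \<in> P \<and> v \<in> C)"

text \<open>
  The algorithm leaves open which vertex is picked, which representatives are chosen, and which
  optimal clique is found, so it is modelled as a nondeterministic transition system:
  \<open>Loop U P\<close> is the state at the head of the while loop, \<open>Reps P W\<close> the state after the
  induced subgraph on \<open>W\<close> has been chosen, \<open>Found P S\<close> the state after the exhaustive search.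
\<close>

datatype 'a fmc_state =
    Loop "'a set" "'a set set"
  | Reps "'a set set" "'a set"
  | Found "'a set set" "'a set"
  | Output "'a set"

inductive fmc_step :: "'a set \<Rightarrow> 'a set set \<Rightarrow> 'a fmc_state \<Rightarrow> 'a fmc_state \<Rightarrow> bool"
  for V :: "'a set" and E :: "'a set set" where
  iterate: "v \<in> U \<Longrightarrow> C = {u \<in> U. closed_twins E u v} \<Longrightarrow>
    fmc_step V E (Loop U P) (Loop (U - C) (insert C P))"
| subgraph: "W \<subseteq> V \<Longrightarrow> \<forall>C \<in> P. \<exists>!w. w \<in> C \<and> w \<in> W \<Longrightarrow>
    fmc_step V E (Loop {} P) (Reps P W)"
| search: "is_arg_max (\<lambda>S. card (\<Union>w \<in> S. part_of P w)) (clique_of W (induced_edges E W)) S \<Longrightarrow>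
    fmc_step V E (Reps P W) (Found P S)"
| finish: "fmc_step V E (Found P S) (Output (\<Union>w \<in> S. part_of P w))"

definition fmc_init :: "'a set \<Rightarrow> 'a fmc_state" where
  "fmc_init V = Loop V {}"

end

theory Submission
  imports Defs
begin

text \<open>
  Adjacency between distinct vertices depends only on their closed-twin classes, and each class is
  a clique. Hence the union of the classes met by a clique is again a clique; so unions of classes
  over cliques of representatives are cliques of the graph, and every clique of the graph is
  contained in such a union.
\<close>

section \<open>Closed twins and their classes\<close>

definition twin_class :: "'a set \<Rightarrow> 'a set set \<Rightarrow> 'a \<Rightarrow> 'a set" where
  "twin_class V E v = {u \<in> V. closed_twins E u v}"

lemma closed_twins_refl: "closed_twins E x x"
  and closed_twins_sym: "closed_twins E x y \<Longrightarrow> closed_twins E y x"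
  and closed_twins_trans: "closed_twins E x y \<Longrightarrow> closed_twins E y z \<Longrightarrow> closed_twins E x z"
  unfolding closed_twins_def by simp_all

text \<open>Membership in a closed neighborhood is symmetric, and twins have the same closed
  neighborhood, so adjacency can be moved from \<open>a\<close> to \<open>x\<close> and then from
  \<open>b\<close> to \<open>y\<close>. The case \<open>a = b\<close> makes each class a
  clique.\<close>

lemma closed_twins_edge:
  assumes "closed_twins E x a" "closed_twins E y b" "a = b \<or> {a, b} \<in> E" "x \<noteq> y"
  shows "{x, y} \<in> E"
proof -
  have sym: "u \<in> neighbors E v \<union> {v} \<longleftrightarrow> v \<in> neighbors E u \<union> {u}" for u v
    by (auto simp: neighbors_def insert_commute)
  have "b \<in> neighbors E a \<union> {a}"
    using assms(3) by (auto simp: neighbors_def)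
  then have "x \<in> neighbors E b \<union> {b}"
    using assms(1) sym by (metis closed_twins_def)
  then have "y \<in> neighbors E x \<union> {x}"
    using assms(2) sym by (metis closed_twins_def)
  then show ?thesis
    using assms(4) by (auto simp: neighbors_def)
qed

lemma twin_class_self: "v \<in> V \<Longrightarrow> v \<in> twin_class V E v"
  by (simp add: twin_class_def closed_twins_refl)

lemma twin_class_eq: "u \<in> twin_class V E v \<Longrightarrow> twin_class V E u = twin_class V E v"
  unfolding twin_class_def by (auto intro: closed_twins_sym closed_twins_trans)

text \<open>Any two classes with a common element coincide. Here \<open>P\<close> may be a proper
  subfamily, since during the loop only some classes have been collected.\<close>

lemma part_eq_twin_class:
  assumes "P \<subseteq> twin_class V E ` V" "C \<in> P" "v \<in> C"
  shows "C = twin_class V E v"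
proof -
  obtain w where "C = twin_class V E w"
    using assms(1,2) by blast
  then show ?thesis
    using twin_class_eq assms(3) by metis
qed

lemma part_of_twin_class:
  assumes "v \<in> V"
  shows "part_of (twin_class V E ` V) v = twin_class V E v"
  unfolding part_of_def
proof (rule the_equality)
  show "twin_class V E v \<in> twin_class V E ` V \<and> v \<in> twin_class V E v"
    using assms by (simp add: twin_class_self)
next
  fix C
  assume "C \<in> twin_class V E ` V \<and> v \<in> C"
  then show "C = twin_class V E v"
    by (elim conjE) (rule part_eq_twin_class[OF subset_refl])
qed

section \<open>Cliques and unions of twin classes\<close>

lemma clique_Union_twin_classes:
  assumes "clique S E"
  shows "clique (\<Union>w\<in>S. twin_class V E w) E"
  unfolding clique_def
proof (intro ballI impI)
  fix x y
  assume "x \<in> (\<Union>w\<in>S. twin_class V E w)" "y \<in> (\<Union>w\<in>S. twin_class V E w)" "x \<noteq> y"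
  then obtain a b where ab: "a \<in> S" "b \<in> S" "closed_twins E x a" "closed_twins E y b"
    by (auto simp: twin_class_def)
  \<comment> \<open>The first alternative is the case of two vertices lying over the same member of
    \<open>S\<close>.\<close>
  then have "a = b \<or> {a, b} \<in> E"
    using assms by (auto simp: clique_def)
  then show "{x, y} \<in> E"
    using closed_twins_edge ab \<open>x \<noteq> y\<close> by metis
qed

lemma clique_of_induced_edges:
  "clique_of W (induced_edges E W) S \<longleftrightarrow> S \<subseteq> W \<and> clique S E"
  unfolding clique_of_def clique_def induced_edges_def by blast

text \<open>Replace each vertex of \<open>K\<close> by its twins in \<open>W\<close>; adjacency
  passes from \<open>K\<close> to these twins, and each vertex of \<open>K\<close> lies in the class
  of one of them.\<close>

lemma clique_covered_by_representatives:
  assumes "K \<subseteq> V" "clique K E"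
    and reps: "\<And>v. v \<in> V \<Longrightarrow> \<exists>w\<in>W. closed_twins E w v"
  shows "\<exists>S\<subseteq>W. clique S E \<and> K \<subseteq> (\<Union>w\<in>S. twin_class V E w)"
proof (intro exI conjI)
  let ?S = "{w \<in> W. \<exists>k\<in>K. closed_twins E w k}"
  show "?S \<subseteq> W" by blast
  show "clique ?S E"
    unfolding clique_def
  proof (intro ballI impI)
    fix x y
    assume "x \<in> ?S" "y \<in> ?S" "x \<noteq> y"
    then obtain a b where ab: "a \<in> K" "b \<in> K" "closed_twins E x a" "closed_twins E y b"
      by blast
    then have "a = b \<or> {a, b} \<in> E"
      using assms(2) by (auto simp: clique_def)
    then show "{x, y} \<in> E"
      using closed_twins_edge ab \<open>x \<noteq> y\<close> by metis
  qed
  show "K \<subseteq> (\<Union>w\<in>?S. twin_class V E w)"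
  proof
    fix k
    assume "k \<in> K"
    then obtain w where "w \<in> W" "closed_twins E w k"
      using reps assms(1) by blast
    then show "k \<in> (\<Union>w\<in>?S. twin_class V E w)"
      using \<open>k \<in> K\<close> assms(1) closed_twins_sym by (fastforce simp: twin_class_def)
  qed
qed

text \<open>Any clique \<open>K\<close> lies in the union over some clique \<open>T\<close> of
  representatives, and \<open>T\<close> competes with \<open>S\<close> in the search, so
  \<open>K\<close> is no larger than the union over \<open>S\<close>.\<close>

lemma maximum_clique_Union_twin_classes:
  assumes "finite V"
    and reps: "\<And>v. v \<in> V \<Longrightarrow> \<exists>w\<in>W. closed_twins E w v"
    and max: "is_arg_max (\<lambda>S. card (\<Union>w\<in>S. twin_class V E w))
      (clique_of W (induced_edges E W)) S"
  shows "maximum_clique V E (\<Union>w\<in>S. twin_class V E w)"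
proof -
  have S: "S \<subseteq> W" "clique S E"
    using max by (auto simp: is_arg_max_def clique_of_induced_edges)
  have sub: "(\<Union>w\<in>T. twin_class V E w) \<subseteq> V" for T
    by (auto simp: twin_class_def)
  have "card K \<le> card (\<Union>w\<in>S. twin_class V E w)" if K: "clique_of V E K" for K
  proof -
    obtain T where T: "T \<subseteq> W" "clique T E" "K \<subseteq> (\<Union>w\<in>T. twin_class V E w)"
      using clique_covered_by_representatives[of K V E W] K reps by (auto simp: clique_of_def)
    have "card K \<le> card (\<Union>w\<in>T. twin_class V E w)"
      using T(3) finite_subset[OF sub assms(1)] by (rule card_mono[rotated])
    also have "\<dots> \<le> card (\<Union>w\<in>S. twin_class V E w)"
      using max T(1,2) by (auto simp: is_arg_max_linorder clique_of_induced_edges)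
    finally show ?thesis .
  qed
  then show ?thesis
    using sub clique_Union_twin_classes[OF S(2)]
    by (auto simp: maximum_clique_def is_arg_max_linorder clique_of_def)
qed

section \<open>Invariant of the algorithm\<close>

fun fmc_inv :: "'a set \<Rightarrow> 'a set set \<Rightarrow> 'a fmc_state \<Rightarrow> bool" where
  "fmc_inv V E (Loop U P) \<longleftrightarrow> U = V - \<Union>P \<and> P \<subseteq> twin_class V E ` V"
| "fmc_inv V E (Reps P W) \<longleftrightarrow> P = twin_class V E ` V \<and> W \<subseteq> V \<and>
    (\<forall>v\<in>V. \<exists>w\<in>W. closed_twins E w v)"
| "fmc_inv V E (Found P S) \<longleftrightarrow> P = twin_class V E ` V \<and> S \<subseteq> V \<and>
    maximum_clique V E (\<Union>w\<in>S. twin_class V E w)"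
| "fmc_inv V E (Output Q) \<longleftrightarrow> maximum_clique V E Q"

lemma fmc_inv_init: "fmc_inv V E (fmc_init V)"
  by (simp add: fmc_init_def)

lemma Union_part_of_twin_class:
  "S \<subseteq> V \<Longrightarrow> (\<Union>w\<in>S. part_of (twin_class V E ` V) w) = (\<Union>w\<in>S. twin_class V E w)"
  using part_of_twin_class by (metis (no_types, lifting) SUP_cong subsetD)

text \<open>The loop only ever removes whole classes, so on exit \<open>P\<close> consists of all
  classes; from there the maximality results on unions of classes apply.\<close>

lemma fmc_inv_step:
  assumes "finite V" "fmc_step V E s t" "fmc_inv V E s"
  shows "fmc_inv V E t"
  using assms(2,3)
proof cases
  case (iterate v U C P)
  have U: "U = V - \<Union>P" and P: "P \<subseteq> twin_class V E ` V"
    using assms(3) iterate by auto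
  \<comment> \<open>If some twin \<open>u\<close> of \<open>v\<close> had been removed with a part
    \<open>D\<close>, then \<open>D\<close> would be the class of \<open>v\<close> and
    \<open>v\<close> would no longer be in \<open>U\<close>.\<close>
  have "twin_class V E v \<subseteq> U"
  proof
    fix u
    assume u: "u \<in> twin_class V E v"
    have "v \<in> D" if "D \<in> P" "u \<in> D" for D
    proof -
      have "D = twin_class V E v"
        using part_eq_twin_class[OF P that] twin_class_eq[OF u] by simp
      then show ?thesis
        using iterate(3) U twin_class_self[of v V E] by simp
    qed
    then show "u \<in> U"
      using u U iterate(3) by (auto simp: twin_class_def)
  qed
  then have "C = twin_class V E v"
    using iterate(4) U by (auto simp: twin_class_def)
  then show ?thesis
    using iterate(2,3) U P by auto
next
  case (subgraph W P)
  have P: "P \<subseteq> twin_class V E ` V" and cover: "V \<subseteq> \<Union>P"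
    using assms(3) subgraph by auto
  \<comment> \<open>With \<open>U\<close> empty the parts cover \<open>V\<close>, and a part
    containing \<open>v\<close> can only be the class of \<open>v\<close>.\<close>
  have mem: "twin_class V E v \<in> P" if v: "v \<in> V" for v
  proof -
    obtain D where "D \<in> P" "v \<in> D"
      using v cover by blast
    moreover from this have "D = twin_class V E v"
      using part_eq_twin_class[OF P] by blast
    ultimately show ?thesis by simp
  qed
  have "\<exists>w\<in>W. closed_twins E w v" if "v \<in> V" for v
    using mem[OF that] subgraph(4) by (fastforce simp: twin_class_def)
  then show ?thesis
    using subgraph(2,3) P mem by auto
next
  case (search P W S)
  have P: "P = twin_class V E ` V" and W: "W \<subseteq> V" "\<And>v. v \<in> V \<Longrightarrow> \<exists>w\<in>W. closed_twins E w v"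
    using assms(3) search by auto
  \<comment> \<open>Cliques in \<open>W\<close> lie in \<open>V\<close>, where
    \<open>part_of P\<close> gives the twin class, so both objectives agree on all
    candidates.\<close>
  have "is_arg_max (\<lambda>S. card (\<Union>w\<in>S. twin_class V E w)) (clique_of W (induced_edges E W)) S"
  proof -
    have "(\<Union>w\<in>T. part_of P w) = (\<Union>w\<in>T. twin_class V E w)"
      if "clique_of W (induced_edges E W) T" for T
      unfolding P using that W(1)
      by (intro Union_part_of_twin_class) (auto simp: clique_of_def)
    then show ?thesis
      using search(3) unfolding is_arg_max_linorder by auto
  qed
  then have "maximum_clique V E (\<Union>w\<in>S. twin_class V E w)" "S \<subseteq> V"
    using maximum_clique_Union_twin_classes[OF assms(1), of W E S] W
    by (auto simp: is_arg_max_def clique_of_def)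
  then show ?thesis
    using search(2) P by simp
next
  case (finish P S)
  then show ?thesis
    using assms(3) Union_part_of_twin_class[of S V E] by simp
qed

section \<open>Termination and progress\<close>

fun fmc_measure :: "'a fmc_state \<Rightarrow> nat" where
  "fmc_measure (Loop U P) = card U + 3"
| "fmc_measure (Reps P W) = 2"
| "fmc_measure (Found P S) = 1"
| "fmc_measure (Output Q) = 0"

text \<open>An iteration removes at least the picked vertex, as it is its own twin. The offset 3
  keeps even \<open>Loop {} P\<close> above the later phases.\<close>

lemma fmc_measure_step:
  assumes "finite V" "fmc_step V E s t" "fmc_inv V E s"
  shows "fmc_measure t < fmc_measure s"
  using assms(2,3)
proof cases
  case (iterate v U C P)
  \<comment> \<open>The invariant puts \<open>U\<close> inside \<open>V\<close>; on an infinite set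
    \<open>card\<close> would be 0 and could not decrease.\<close>
  have "finite U"
    using assms(1,3) iterate(1) by simp
  moreover have "v \<in> C"
    using iterate by (simp add: closed_twins_refl)
  ultimately have "card (U - C) < card U"
    using iterate(3) by (intro psubset_card_mono) auto
  then show ?thesis
    using iterate by simp
qed simp_all

text \<open>Each earlier phase can move on: a nonempty \<open>U\<close> offers a vertex, nonempty
  disjoint classes offer representatives, and finitely many cliques offer an optimal one.\<close>

lemma fmc_progress:
  assumes "finite V" "fmc_inv V E s" "\<nexists>t. fmc_step V E s t"
  shows "\<exists>Q. s = Output Q"
proof (cases s)
  case (Loop U P)
  show ?thesis
  proof (cases "U = {}")
    case False
    then obtain v where "v \<in> U" by blast
    from fmc_step.iterate[OF this refl] show ?thesis
      using assms(3) unfolding Loop by blast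
  next
    case True
    have P: "P \<subseteq> twin_class V E ` V"
      using assms(2) Loop by simp
    define r where "r C = (SOME w. w \<in> C)" for C :: "'a set"
    have r: "r C \<in> C" if "C \<in> P" for C
    proof -
      obtain v where "v \<in> V" "C = twin_class V E v"
        using \<open>C \<in> P\<close> P by blast
      then have "v \<in> C"
        by (simp add: twin_class_self)
      then show ?thesis
        unfolding r_def by (rule someI)
    qed
    \<comment> \<open>If \<open>w\<close> is the chosen element of \<open>D\<close> and also lies in
      \<open>C\<close>, the classes \<open>C\<close> and \<open>D\<close> meet and hence are
      equal.\<close>
    have uniq: "w = r C" if "C \<in> P" "w \<in> C" "w \<in> r ` P" for w C
    proof -
      obtain D where D: "D \<in> P" "w = r D"
        using \<open>w \<in> r ` P\<close> by blast
      then have "D = C"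
        using that(1,2) r part_eq_twin_class[OF P] by metis
      then show ?thesis
        using D by simp
    qed
    have "\<exists>!w. w \<in> C \<and> w \<in> r ` P" if "C \<in> P" for C
      using that r uniq by (intro ex1I[of _ "r C"]) simp_all
    moreover have "r ` P \<subseteq> V"
    proof
      fix x
      assume "x \<in> r ` P"
      then obtain C where "C \<in> P" "x \<in> C"
        using r by blast
      then show "x \<in> V"
        using P by (auto simp: twin_class_def)
    qed
    ultimately have "fmc_step V E s (Reps P (r ` P))"
      unfolding Loop True by (intro fmc_step.subgraph) simp_all
    then show ?thesis
      using assms(3) by blast
  qed
next
  case (Reps P W)
  let ?C = "clique_of W (induced_edges E W)" and ?f = "\<lambda>S. card (\<Union>w\<in>S. part_of P w)"
  have "finite W"
    using assms(1,2) Reps by (auto intro: finite_subset)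
  moreover have "Collect ?C \<subseteq> Pow W"
    by (auto simp: clique_of_def)
  ultimately have fin: "finite (Collect ?C)"
    using finite_subset by blast
  \<comment> \<open>The empty clique guarantees a candidate, so the maximum over the finite family
    exists.\<close>
  have "{} \<in> Collect ?C"
    by (simp add: clique_of_def clique_def)
  then have "Collect ?C \<noteq> {}" by blast
  from obtains_MAX[OF fin this] obtain S
    where S: "S \<in> Collect ?C" "Max (?f ` Collect ?C) = ?f S" .
  have "?f T \<le> ?f S" if "?C T" for T
    using that fin unfolding S(2)[symmetric] by (intro Max_ge) auto
  then have "is_arg_max ?f ?C S"
    using S(1) unfolding is_arg_max_linorder by blast
  from fmc_step.search[OF this] show ?thesis
    using assms(3) unfolding Reps by blast
next
  case (Found P S)
  show ?thesis
    using assms(3) fmc_step.finish[of V E P S] unfolding Found by blast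
qed simp

text \<open>The choices are nondeterministic, so correctness concerns every run: termination
  excludes endless runs, and the claim on stuck states excludes both deadlock and wrong
  output.\<close>

theorem theorem1:
  fixes V :: "'a set" and E :: "'a set set"
  assumes "fin_graph V E"
  shows "(\<nexists>\<sigma> :: nat \<Rightarrow> 'a fmc_state. \<sigma> 0 = fmc_init V \<and> (\<forall>i. fmc_step V E (\<sigma> i) (\<sigma> (Suc i)))) \<and>
    (\<forall>s. (fmc_step V E)\<^sup>*\<^sup>* (fmc_init V) s \<and> (\<nexists>s'. fmc_step V E s s') \<longrightarrow>
      (\<exists>Q. s = Output Q \<and> maximum_clique V E Q))"
proof (intro conjI allI impI notI)
  have V: "finite V"
    using assms by (simp add: fin_graph_def)
  {
    assume "\<exists>\<sigma> :: nat \<Rightarrow> 'a fmc_state. \<sigma> 0 = fmc_init V \<and> (\<forall>i. fmc_step V E (\<sigma> i) (\<sigma> (Suc i)))"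
    then obtain \<sigma> :: "nat \<Rightarrow> 'a fmc_state"
      where \<sigma>: "\<sigma> 0 = fmc_init V" "\<And>i. fmc_step V E (\<sigma> i) (\<sigma> (Suc i))"
      by blast
    \<comment> \<open>The measure is known to drop only from states satisfying the invariant, so the
      invariant is first carried along the run.\<close>
    have "fmc_inv V E (\<sigma> i)" for i
      by (induction i) (use \<sigma> fmc_inv_init fmc_inv_step[OF V] in \<open>metis+\<close>)
    then have "(\<sigma> (Suc i), \<sigma> i) \<in> measure fmc_measure" for i
      using fmc_measure_step[OF V \<sigma>(2)] by simp
    then show False
      using wf_measure[of fmc_measure] unfolding wf_iff_no_infinite_down_chain by blast
  next
    fix s
    assume s: "(fmc_step V E)\<^sup>*\<^sup>* (fmc_init V) s \<and> (\<nexists>s'. fmc_step V E s s')"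
    then have "(fmc_step V E)\<^sup>*\<^sup>* (fmc_init V) s" by blast
    then have "fmc_inv V E s"
      by induction (use fmc_inv_init fmc_inv_step[OF V] in \<open>metis+\<close>)
    moreover from this obtain Q where "s = Output Q"
      using fmc_progress[OF V] s by blast
    ultimately show "\<exists>Q. s = Output Q \<and> maximum_clique V E Q"
      by simp
  }
qed

end
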